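(* Let $n\ge 0$ be an integer and $c>0$. Let $X$ be a metric space and $A\subset X$ a subset satisfying $\mathrm{Nagata}(n,c)$. Suppose that $Y$ is a non-empty complete metric space of generalized non-positive curvature. Then every $1$-Lipschitz map $f\colon A\to Y$ admits a Lipschitz extension $F\colon X\to Y$ with Lipschitz constant at most $$1000\cdot (c+1)\cdot \log_2(n+2).$$
   Context: A covering of a metric space (by arbitrary subsets) has $s$-multiplicity at most $m$ if every subset of the space of diameter less than $s$ meets at most $m$ members of the covering. A metric space $Z$ satisfies $\mathrm{Nagata}(n,c)$ if for every $s>0$ there is a covering of $Z$ which has $s$-multiplicity at most $n+1$ and each of whose members has diameter at most $c\cdot s$. The subset $A$ is considered with the induced metric. A metric space $Y$ is a space of generalized non-positive curvature if it admits a symmetric map $m\colon Y\times Y\to Y$ (i.e. $m(x,y)=m(y,x)$) such that $m(y,y)=y$ for all $y\in Y$ and $d(m(x,y),m(x,z))\le \tfrac12 d(y,z)$ for all $x,y,z\in Y$. *)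

theory Defs
  imports "HOL-Analysis.Analysis"
begin

text \<open>
  A metric space is a set \<open>Z\<close> of points of a metric type, with the induced metric.
  The library's \<^const>\<open>diameter\<close> is only meaningful on bounded sets, hence the explicit
  \<^const>\<open>bounded\<close> wherever a diameter is bounded from above.
\<close>

definition covering :: "'a set \<Rightarrow> 'a set set \<Rightarrow> bool" where
  "covering Z \<C> \<longleftrightarrow> (\<forall>B\<in>\<C>. B \<subseteq> Z) \<and> \<Union>\<C> = Z"

definition multiplicity_at_most :: "'a::metric_space set \<Rightarrow> real \<Rightarrow> nat \<Rightarrow> 'a set set \<Rightarrow> bool" where
  "multiplicity_at_most Z s m \<C> \<longleftrightarrow>
     (\<forall>D. D \<subseteq> Z \<and> bounded D \<and> diameter D < s \<longrightarrow>
        finite {B \<in> \<C>. B \<inter> D \<noteq> {}} \<and> card {B \<in> \<C>. B \<inter> D \<noteq> {}} \<le> m)"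

definition Nagata :: "nat \<Rightarrow> real \<Rightarrow> 'a::metric_space set \<Rightarrow> bool" where
  "Nagata n c Z \<longleftrightarrow>
     (\<forall>s>0. \<exists>\<C>. covering Z \<C> \<and> multiplicity_at_most Z s (n + 1) \<C> \<and>
        (\<forall>B\<in>\<C>. bounded B \<and> diameter B \<le> c * s))"

definition generalized_nonpos_curvature :: "'b::metric_space set \<Rightarrow> bool" where
  "generalized_nonpos_curvature Y \<longleftrightarrow>
     (\<exists>m. (\<forall>x\<in>Y. \<forall>y\<in>Y. m x y \<in> Y) \<and>
          (\<forall>x\<in>Y. \<forall>y\<in>Y. m x y = m y x) \<and>
          (\<forall>y\<in>Y. m y y = y) \<and>
          (\<forall>x\<in>Y. \<forall>y\<in>Y. \<forall>z\<in>Y. dist (m x y) (m x z) \<le> 1 / 2 * dist y z))"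

end

theory Submission
  imports Defs
begin

text \<open>
  Repeated bisection turns the midpoint map of \<open>Y\<close> into a conical bicombing \<open>\<sigma> y z p\<close>, the point
  at parameter \<open>p\<close> on the way from \<open>z\<close> to \<open>y\<close>. For every integer \<open>j\<close> take a Nagata covering of \<open>A\<close>
  at scale \<open>5 * 2^j\<close>, and order all pairs \<open>(j, B)\<close> linearly, by increasing \<open>j\<close> first. The value
  \<open>F x\<close> is the "expected value" of the following random experiment: run through the pairs in this
  order, stop at \<open>(j, B)\<close> with probability \<open>h (dist(x, B) / 2^j)\<close>, and return the value of \<open>f\<close> at
  a chosen point of \<open>B\<close>. The expectation is realised by nesting \<open>\<sigma>\<close>. The cutoff \<open>h\<close> equals \<open>1\<close> on
  \<open>(-\<infinity>, 1]\<close> and \<open>0\<close> on \<open>[2, \<infinity>)\<close>, so that only pairs with \<open>2^j\<close> comparable to \<open>dist(x, A)\<close>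
  matter, at most \<open>2 (n + 1)\<close> of them. In between \<open>h\<close> decays exponentially with rate of order
  \<open>log (n + 2)\<close>: a small move of \<open>x\<close> changes each stopping probability by at most this rate times
  the probability itself, up to an error of order \<open>1 / (n + 1)\<close>. Since the stopping probabilities,
  weighted by survival, add up to at most \<open>1\<close>, the total change is of order \<open>log (n + 2)\<close> and not
  \<open>n\<close>.
\<close>

section \<open>Conical bicombings from midpoint maps\<close>

text \<open>Each binary digit of \<open>p\<close> selects the endpoint with which the point built
  from the remaining digits is averaged. The base case singles out \<open>p = 1\<close>, a fixed
  point of \<open>2 * p - 1\<close>, so that both ends of the curve are exact at every
  depth.\<close>

fun bisect :: "('b \<Rightarrow> 'b \<Rightarrow> 'b) \<Rightarrow> nat \<Rightarrow> 'b \<Rightarrow> 'b \<Rightarrow> real \<Rightarrow> 'b" where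
  "bisect m 0 y z p = (if p = 1 then y else z)"
| "bisect m (Suc k) y z p =
     (if p < 1/2 then m z (bisect m k y z (2 * p)) else m y (bisect m k y z (2 * p - 1)))"

locale midpoint_map =
  fixes Y :: "'b::metric_space set" and m :: "'b \<Rightarrow> 'b \<Rightarrow> 'b"
  assumes mid_in: "x \<in> Y \<Longrightarrow> y \<in> Y \<Longrightarrow> m x y \<in> Y"
    and mid_commute: "x \<in> Y \<Longrightarrow> y \<in> Y \<Longrightarrow> m x y = m y x"
    and mid_idem: "y \<in> Y \<Longrightarrow> m y y = y"
    and mid_contract: "x \<in> Y \<Longrightarrow> y \<in> Y \<Longrightarrow> z \<in> Y \<Longrightarrow> dist (m x y) (m x z) \<le> 1/2 * dist y z"
begin

lemma mid_dist:
  assumes "x \<in> Y" "y \<in> Y" "x' \<in> Y" "y' \<in> Y"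
  shows "dist (m x y) (m x' y') \<le> (dist x x' + dist y y') / 2"
proof -
  have "dist (m x y) (m x' y') \<le> dist (m x y) (m x y') + dist (m x y') (m x' y')"
    by (rule dist_triangle)
  moreover have "dist (m x y') (m x' y') \<le> 1/2 * dist x x'"
    using mid_contract[of y' x x'] mid_commute assms by metis
  ultimately show ?thesis
    using mid_contract[of x y y'] assms by argo
qed

lemma mid_dist_right:
  assumes "x \<in> Y" "y \<in> Y"
  shows "dist (m x y) y \<le> dist x y / 2"
  using mid_dist[of x y y y] assms by (simp add: mid_idem)

lemma bisect_in: "y \<in> Y \<Longrightarrow> z \<in> Y \<Longrightarrow> bisect m k y z p \<in> Y"
  by (induction k arbitrary: p) (auto intro: mid_in)

lemma bisect_0: "y \<in> Y \<Longrightarrow> z \<in> Y \<Longrightarrow> bisect m k y z 0 = z"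
  by (induction k) (auto simp: mid_idem)

lemma bisect_1: "y \<in> Y \<Longrightarrow> z \<in> Y \<Longrightarrow> bisect m k y z 1 = y"
  by (induction k) (auto simp: mid_idem)

lemma bisect_dist_left:
  assumes "y \<in> Y" "z \<in> Y" "0 \<le> p" "p \<le> 1"
  shows "dist (bisect m k y z p) y \<le> (1 - p + (1/2)^k) * dist y z"
  using assms(3,4)
proof (induction k arbitrary: p)
  case 0
  then show ?case
    by (auto simp: dist_commute mult_le_cancel_right1)
next
  case (Suc k)
  show ?case
  proof (cases "p < 1/2")
    case True
    have "dist (m z (bisect m k y z (2*p))) y \<le> (dist z y + dist (bisect m k y z (2*p)) y) / 2"
      using mid_dist[of z "bisect m k y z (2*p)" y y] assms bisect_in by (simp add: mid_idem)
    also have "\<dots> \<le> (dist z y + (1 - 2*p + (1/2)^k) * dist y z) / 2"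
      using Suc.IH[of "2*p"] True Suc.prems by simp
    finally show ?thesis
      using True by (simp add: dist_commute algebra_simps)
  next
    case False
    have "dist (m y (bisect m k y z (2*p-1))) y \<le> dist (bisect m k y z (2*p-1)) y / 2"
      using mid_dist[of y "bisect m k y z (2*p-1)" y y] assms bisect_in by (simp add: mid_idem)
    also have "\<dots> \<le> ((1 - (2*p-1) + (1/2)^k) * dist y z) / 2"
      using Suc.IH[of "2*p-1"] False Suc.prems by simp
    finally show ?thesis
      using False by (simp add: algebra_simps)
  qed
qed

lemma bisect_dist_right:
  assumes "y \<in> Y" "z \<in> Y" "0 \<le> p" "p \<le> 1"
  shows "dist (bisect m k y z p) z \<le> (p + (1/2)^k) * dist y z"
  using assms(3,4)
proof (induction k arbitrary: p)
  case 0
  then show ?case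
    by (auto simp: dist_commute mult_le_cancel_right1)
next
  case (Suc k)
  show ?case
  proof (cases "p < 1/2")
    case True
    have "dist (m z (bisect m k y z (2*p))) z \<le> dist (bisect m k y z (2*p)) z / 2"
      using mid_dist[of z "bisect m k y z (2*p)" z z] assms bisect_in by (simp add: mid_idem)
    also have "\<dots> \<le> ((2*p + (1/2)^k) * dist y z) / 2"
      using Suc.IH[of "2*p"] True Suc.prems by simp
    finally show ?thesis
      using True by (simp add: algebra_simps)
  next
    case False
    have "dist (m y (bisect m k y z (2*p-1))) z \<le> (dist y z + dist (bisect m k y z (2*p-1)) z) / 2"
      using mid_dist[of y "bisect m k y z (2*p-1)" z z] assms bisect_in by (simp add: mid_idem)
    also have "\<dots> \<le> (dist y z + (2*p-1 + (1/2)^k) * dist y z) / 2"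
      using Suc.IH[of "2*p-1"] False Suc.prems by simp
    finally show ?thesis
      using False by (simp add: algebra_simps)
  qed
qed

lemma bisect_parameter:
  assumes "y \<in> Y" "z \<in> Y" "0 \<le> p" "p \<le> q" "q \<le> 1"
  shows "dist (bisect m k y z p) (bisect m k y z q) \<le> (q - p + 2 * (1/2)^k) * dist y z"
  using assms(3-)
proof (induction k arbitrary: p q)
  case 0
  then show ?case
    by (auto simp: dist_commute mult_le_cancel_right1)
next
  case (Suc k)
  consider "q < 1/2" | "p < 1/2" "q \<ge> 1/2" | "p \<ge> 1/2" by linarith
  then show ?case
  proof cases
    case 1
    have "dist (m z (bisect m k y z (2*p))) (m z (bisect m k y z (2*q)))
        \<le> 1/2 * dist (bisect m k y z (2*p)) (bisect m k y z (2*q))"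
      using assms by (intro mid_contract bisect_in)
    also have "\<dots> \<le> 1/2 * ((2*q - 2*p + 2 * (1/2)^k) * dist y z)"
      using Suc.IH[of "2*p" "2*q"] 1 Suc.prems by simp
    finally show ?thesis
      using 1 Suc.prems by (simp add: algebra_simps)
  next
    case 2
    \<comment> \<open>The parameters lie on either side of 1/2, so the points are compared through
      the common midpoint \<open>m z y = m y z\<close>. Two truncation errors enter here, which
      explains the factor 2 in front of \<open>(1/2)^k\<close>.\<close>
    have "dist (m z (bisect m k y z (2*p))) (m y (bisect m k y z (2*q-1)))
        \<le> dist (m z (bisect m k y z (2*p))) (m z y) + dist (m y z) (m y (bisect m k y z (2*q-1)))"
      using dist_triangle mid_commute assms by metis
    also have "\<dots> \<le> 1/2 * dist (bisect m k y z (2*p)) y + 1/2 * dist z (bisect m k y z (2*q-1))"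
      using assms by (intro mid_contract bisect_in add_mono)
    also have "\<dots> \<le> 1/2 * ((1 - 2*p + (1/2)^k) * dist y z) + 1/2 * ((2*q-1 + (1/2)^k) * dist y z)"
      using bisect_dist_left[of y z "2*p" k] bisect_dist_right[of y z "2*q-1" k] 2 Suc.prems assms
      by (simp add: dist_commute)
    finally show ?thesis
      using 2 by (simp add: algebra_simps)
  next
    case 3
    have "dist (m y (bisect m k y z (2*p-1))) (m y (bisect m k y z (2*q-1)))
        \<le> 1/2 * dist (bisect m k y z (2*p-1)) (bisect m k y z (2*q-1))"
      using assms by (intro mid_contract bisect_in)
    also have "\<dots> \<le> 1/2 * (((2*q-1) - (2*p-1) + 2 * (1/2)^k) * dist y z)"
      using Suc.IH[of "2*p-1" "2*q-1"] 3 Suc.prems by simp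
    finally show ?thesis
      using 3 Suc.prems by (simp add: algebra_simps)
  qed
qed

text \<open>Both curves read the same digits of \<open>p\<close>, so \<open>mid_dist\<close> applies
  digit by digit; the halved endpoint distances accumulate to the weights \<open>p\<close> and
  \<open>1 - p\<close>.\<close>

lemma bisect_conical:
  assumes "y \<in> Y" "z \<in> Y" "y' \<in> Y" "z' \<in> Y" "0 \<le> p" "p \<le> 1"
  shows "dist (bisect m k y z p) (bisect m k y' z' p)
    \<le> p * dist y y' + (1 - p) * dist z z' + (1/2)^k * (dist y y' + dist z z')"
  using assms(5-)
proof (induction k arbitrary: p)
  case 0
  then have "0 \<le> p * dist y y'" "0 \<le> (1 - p) * dist z z'"
    by auto
  then show ?case
    using zero_le_dist[of y y'] zero_le_dist[of z z'] by (simp add: add_increasing)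
next
  case (Suc k)
  let ?b = "\<lambda>p. bisect m k y z p" and ?b' = "\<lambda>p. bisect m k y' z' p"
  show ?case
  proof (cases "p < 1/2")
    case True
    have "dist (m z (?b (2*p))) (m z' (?b' (2*p))) \<le> (dist z z' + dist (?b (2*p)) (?b' (2*p))) / 2"
      using assms by (intro mid_dist bisect_in)
    also have "\<dots> \<le> (dist z z' + (2*p * dist y y' + (1 - 2*p) * dist z z'
        + (1/2)^k * (dist y y' + dist z z'))) / 2"
      using Suc.IH[of "2*p"] Suc.prems True by simp
    also have "\<dots> = p * dist y y' + (1 - p) * dist z z' + (1/2)^Suc k * (dist y y' + dist z z')"
      by (simp add: field_simps)
    finally show ?thesis
      using True by simp
  next
    case False
    have "dist (m y (?b (2*p-1))) (m y' (?b' (2*p-1)))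
        \<le> (dist y y' + dist (?b (2*p-1)) (?b' (2*p-1))) / 2"
      using assms by (intro mid_dist bisect_in)
    also have "\<dots> \<le> (dist y y' + ((2*p-1) * dist y y' + (1 - (2*p-1)) * dist z z'
        + (1/2)^k * (dist y y' + dist z z'))) / 2"
      using Suc.IH[of "2*p-1"] Suc.prems False by simp
    also have "\<dots> = p * dist y y' + (1 - p) * dist z z' + (1/2)^Suc k * (dist y y' + dist z z')"
      by (simp add: field_simps)
    finally show ?thesis
      using False by simp
  qed
qed

text \<open>Depths \<open>k\<close> and \<open>Suc k\<close> share their \<open>k\<close> outer
  averaging steps, each of which contracts by 1/2, and differ only in the innermost one.\<close>

lemma bisect_Suc_dist:
  assumes "y \<in> Y" "z \<in> Y" "0 \<le> p" "p \<le> 1"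
  shows "dist (bisect m k y z p) (bisect m (Suc k) y z p) \<le> (1/2)^k * dist y z"
  using assms(3,4)
proof (induction k arbitrary: p)
  case 0
  have "dist z (m y z) \<le> dist y z"
    using mid_dist_right[of y z] assms(1,2) zero_le_dist[of y z]
    by (simp add: dist_commute[of z] del: zero_le_dist)
  then show ?case
    using 0 assms(1,2) by (auto simp: mid_idem)
next
  case (Suc k)
  show ?case
  proof (cases "p < 1/2")
    case True
    have "dist (m z (bisect m k y z (2*p))) (m z (bisect m (Suc k) y z (2*p)))
        \<le> 1/2 * dist (bisect m k y z (2*p)) (bisect m (Suc k) y z (2*p))"
      using assms by (intro mid_contract bisect_in)
    also have "\<dots> \<le> 1/2 * ((1/2)^k * dist y z)"
      using Suc.IH[of "2*p"] Suc.prems True by simp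
    finally show ?thesis
      using True by (simp del: bisect.simps add: bisect.simps(2)[of m k y z p] bisect.simps(2)[of m "Suc k" y z p])
  next
    case False
    have "dist (m y (bisect m k y z (2*p-1))) (m y (bisect m (Suc k) y z (2*p-1)))
        \<le> 1/2 * dist (bisect m k y z (2*p-1)) (bisect m (Suc k) y z (2*p-1))"
      using assms by (intro mid_contract bisect_in)
    also have "\<dots> \<le> 1/2 * ((1/2)^k * dist y z)"
      using Suc.IH[of "2*p-1"] Suc.prems False by simp
    finally show ?thesis
      using False by (simp del: bisect.simps add: bisect.simps(2)[of m k y z p] bisect.simps(2)[of m "Suc k" y z p])
  qed
qed

end

section \<open>From finite bisection to conical bicombings\<close>

lemma Cauchy_if_geometric_steps:
  fixes g :: "nat \<Rightarrow> 'b::metric_space"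
  assumes step: "\<And>k. dist (g k) (g (Suc k)) \<le> (1/2)^k * d"
  shows "Cauchy g"
proof -
  have tele: "dist (g k) (g (k + r)) \<le> 2 * ((1/2)^k - (1/2)^(k + r)) * d" for k r
  proof (induction r)
    case (Suc r)
    have "dist (g k) (g (k + Suc r)) \<le> dist (g k) (g (k + r)) + dist (g (k + r)) (g (Suc (k + r)))"
      by (simp add: dist_triangle)
    also have "\<dots> \<le> 2 * ((1/2)^k - (1/2)^(k + r)) * d + (1/2)^(k + r) * d"
      using Suc step by (intro add_mono)
    finally show ?case by (simp add: algebra_simps)
  qed simp
  have "d \<ge> 0"
    using step[of 0] by (simp add: order_trans[OF zero_le_dist])
  have bound: "dist (g k) (g l) \<le> 2 * (1/2)^k * d" if "k \<le> l" for k l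
  proof -
    have "2 * ((1/2)^k - (1/2)^(k + (l - k))) * d \<le> 2 * (1/2)^k * d"
      using \<open>d \<ge> 0\<close> by (simp add: algebra_simps)
    with tele[of k "l - k"] that show ?thesis
      by simp
  qed
  have "(\<lambda>k. 2 * (1/2)^k * d) \<longlonglongrightarrow> 2 * 0 * d"
    by (intro tendsto_intros) auto
  then show ?thesis
    unfolding Cauchy_altdef2
  proof (intro allI impI)
    fix e :: real assume "e > 0"
    with \<open>(\<lambda>k. 2 * (1/2)^k * d) \<longlonglongrightarrow> 2 * 0 * d\<close> obtain N where "2 * (1/2)^N * d < e"
      by (metis (no_types, lifting) eventually_sequentially mult_zero_left mult_zero_right order_refl order_tendstoD(2))
    then have "\<forall>l\<ge>N. dist (g l) (g N) < e"
      using bound[of N] by (metis dist_commute le_less_trans)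
    then show "\<exists>N. \<forall>l\<ge>N. dist (g l) (g N) < e" ..
  qed
qed

text \<open>\<open>p\<close> is the weight of \<open>y\<close>, so that it can serve as a stopping
  probability in \<open>chain\<close>. The endpoint conditions and the speed bound together make
  each curve a geodesic of constant speed.\<close>

locale conical_bicombing =
  fixes Y :: "'b::metric_space set" and \<sigma> :: "'b \<Rightarrow> 'b \<Rightarrow> real \<Rightarrow> 'b"
  assumes bicomb_in: "y \<in> Y \<Longrightarrow> z \<in> Y \<Longrightarrow> 0 \<le> p \<Longrightarrow> p \<le> 1 \<Longrightarrow> \<sigma> y z p \<in> Y"
    and bicomb_0: "y \<in> Y \<Longrightarrow> z \<in> Y \<Longrightarrow> \<sigma> y z 0 = z"
    and bicomb_1: "y \<in> Y \<Longrightarrow> z \<in> Y \<Longrightarrow> \<sigma> y z 1 = y"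
    and bicomb_parameter: "y \<in> Y \<Longrightarrow> z \<in> Y \<Longrightarrow> 0 \<le> p \<Longrightarrow> p \<le> q \<Longrightarrow> q \<le> 1 \<Longrightarrow>
          dist (\<sigma> y z p) (\<sigma> y z q) \<le> (q - p) * dist y z"
    and bicomb_conical: "y \<in> Y \<Longrightarrow> z \<in> Y \<Longrightarrow> y' \<in> Y \<Longrightarrow> z' \<in> Y \<Longrightarrow> 0 \<le> p \<Longrightarrow> p \<le> 1 \<Longrightarrow>
          dist (\<sigma> y z p) (\<sigma> y' z' p) \<le> p * dist y y' + (1 - p) * dist z z'"

text \<open>Completeness provides pointwise limits of the bisection curves. Their metric estimates
  miss the bicombing axioms only by multiples of \<open>(1/2)^k\<close>, which vanish in the
  limit.\<close>

lemma (in midpoint_map) conical_bicombing_exists: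
  assumes "complete Y"
  shows "\<exists>\<sigma>. conical_bicombing Y \<sigma>"
proof -
  define \<sigma> where "\<sigma> = (\<lambda>y z p. lim (\<lambda>k. bisect m k y z p))"
  have conv: "\<sigma> y z p \<in> Y \<and> (\<lambda>k. bisect m k y z p) \<longlonglongrightarrow> \<sigma> y z p"
    if yzp: "y \<in> Y" "z \<in> Y" "0 \<le> p" "p \<le> 1" for y z p
  proof -
    have "Cauchy (\<lambda>k. bisect m k y z p)"
      using bisect_Suc_dist yzp by (intro Cauchy_if_geometric_steps)
    then obtain l where "l \<in> Y" "(\<lambda>k. bisect m k y z p) \<longlonglongrightarrow> l"
      using completeE[OF assms] bisect_in[OF yzp(1,2)] by metis
    then show ?thesis
      unfolding \<sigma>_def by (metis limI)
  qed
  have half: "(\<lambda>k. (1/2)^k) \<longlonglongrightarrow> (0::real)"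
    by (intro LIMSEQ_power_zero) simp
  have "conical_bicombing Y \<sigma>"
  proof
    fix y z assume yz: "y \<in> Y" "z \<in> Y"
    show "\<sigma> y z 0 = z" "\<sigma> y z 1 = y"
      by (simp_all add: \<sigma>_def bisect_0 bisect_1 yz)
    fix p :: real assume p: "0 \<le> p"
    show "\<sigma> y z p \<in> Y" if "p \<le> 1"
      using conv yz p that by blast
    show "dist (\<sigma> y z p) (\<sigma> y z q) \<le> (q - p) * dist y z" if "p \<le> q" "q \<le> 1" for q
    proof (rule tendsto_le[OF sequentially_bot])
      show "(\<lambda>k. (q - p + 2 * (1/2)^k) * dist y z) \<longlonglongrightarrow> (q - p) * dist y z"
        using half by (auto intro!: tendsto_eq_intros)
      show "(\<lambda>k. dist (bisect m k y z p) (bisect m k y z q)) \<longlonglongrightarrow> dist (\<sigma> y z p) (\<sigma> y z q)"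
        using conv yz p that by (intro tendsto_dist) auto
    qed (use bisect_parameter yz p that in auto)
    show "dist (\<sigma> y z p) (\<sigma> y' z' p) \<le> p * dist y y' + (1 - p) * dist z z'"
      if "y' \<in> Y" "z' \<in> Y" "p \<le> 1" for y' z'
    proof (rule tendsto_le[OF sequentially_bot])
      show "(\<lambda>k. p * dist y y' + (1 - p) * dist z z' + (1/2)^k * (dist y y' + dist z z'))
          \<longlonglongrightarrow> p * dist y y' + (1 - p) * dist z z'"
        using half by (auto intro!: tendsto_eq_intros)
      show "(\<lambda>k. dist (bisect m k y z p) (bisect m k y' z' p)) \<longlonglongrightarrow> dist (\<sigma> y z p) (\<sigma> y' z' p)"
        using conv yz p that by (intro tendsto_dist) auto
    qed (use bisect_conical yz p that in auto)
  qed
  then show ?thesis by blast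
qed

section \<open>Iterated convex combinations\<close>

context conical_bicombing
begin

text \<open>Comparison with the constant curve \<open>\<sigma> w w p = w\<close> turns the conical
  inequality into convexity of the distance to \<open>w\<close>.\<close>

lemma bicomb_ball:
  assumes "y \<in> Y" "z \<in> Y" "w \<in> Y" "0 \<le> p" "p \<le> 1" "dist w y \<le> R" "dist w z \<le> R"
  shows "dist w (\<sigma> y z p) \<le> R"
proof -
  have "dist (\<sigma> w w 0) (\<sigma> w w p) \<le> p * dist w w"
    using bicomb_parameter[of w w 0 p] assms by simp
  then have "\<sigma> w w p = w"
    using assms by (simp add: bicomb_0)
  then have "dist w (\<sigma> y z p) \<le> p * dist w y + (1 - p) * dist w z"
    using bicomb_conical[of w w y z p] assms by simp
  also have "\<dots> \<le> R"
    using assms by (intro convex_bound_le) auto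
  finally show ?thesis .
qed

text \<open>The nested expectation of the stopping experiment: the head of \<open>L\<close> is tried
  first, \<open>p i\<close> is the probability of stopping at \<open>i\<close>, and \<open>z\<close>
  is the outcome if nothing stops.\<close>

definition chain :: "('i \<Rightarrow> 'b) \<Rightarrow> ('i \<Rightarrow> real) \<Rightarrow> 'i list \<Rightarrow> 'b \<Rightarrow> 'b" where
  "chain v p L z = foldr (\<lambda>i z. \<sigma> (v i) z (p i)) L z"

lemma chain_Nil [simp]: "chain v p [] z = z"
  and chain_Cons [simp]: "chain v p (i # L) z = \<sigma> (v i) (chain v p L z) (p i)"
  by (simp_all add: chain_def)

context
  fixes v :: "'i \<Rightarrow> 'b" and p :: "'i \<Rightarrow> real"
  assumes v_in: "\<And>i. v i \<in> Y" and p_ge_0: "\<And>i. 0 \<le> p i" and p_le_1: "\<And>i. p i \<le> 1"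
begin

lemma chain_in: "z \<in> Y \<Longrightarrow> chain v p L z \<in> Y"
  by (induction L) (auto intro: bicomb_in v_in p_ge_0 p_le_1)

lemma chain_ball:
  assumes "w \<in> Y" "z \<in> Y" "dist w z \<le> R" "\<And>i. i \<in> set L \<Longrightarrow> dist w (v i) \<le> R"
  shows "dist w (chain v p L z) \<le> R"
  using assms(4)
  by (induction L) (auto intro!: bicomb_ball chain_in v_in p_ge_0 p_le_1 assms(1-3))

lemma chain_base_irrelevant:
  assumes "z \<in> Y" "z' \<in> Y" "\<exists>k\<in>set L. p k = 1"
  shows "chain v p L z = chain v p L z'"
  using assms(3)
proof (induction L)
  case (Cons i L)
  then show ?case
    by (cases "p i = 1") (auto simp: bicomb_1 v_in chain_in assms)
qed simp

text \<open>An index outside \<open>K\<close> may be dropped if it is never chosen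
  (\<open>p i = 0\<close>) or never reached: in the sorted list, \<open>\<not> le i k\<close> puts
  \<open>i\<close> behind the sure stop \<open>k\<close>, which is kept.\<close>

lemma chain_filter:
  assumes "z \<in> Y" "sorted_wrt le L"
    and "\<And>i. i \<in> set L \<Longrightarrow> i \<notin> K \<Longrightarrow> p i = 0 \<or> (\<exists>k\<in>set L \<inter> K. p k = 1 \<and> \<not> le i k)"
  shows "chain v p L z = chain v p (filter (\<lambda>i. i \<in> K) L) z"
  using assms(2,3)
proof (induction L)
  case (Cons i L)
  show ?case
  proof (cases "i \<in> K")
    case True
    show ?thesis
    proof (cases "p i = 1")
      case True
      then show ?thesis
        using \<open>i \<in> K\<close> by (simp add: bicomb_1 v_in chain_in \<open>z \<in> Y\<close>)
    next
      case False
      have "chain v p L z = chain v p (filter (\<lambda>i. i \<in> K) L) z"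
      proof (rule Cons.IH)
        show "p j = 0 \<or> (\<exists>k\<in>set L \<inter> K. p k = 1 \<and> \<not> le j k)" if "j \<in> set L" "j \<notin> K" for j
          using Cons.prems(2)[of j] that False by auto
      qed (use Cons.prems in auto)
      then show ?thesis
        using True by simp
    qed
  next
    case False
    then have "p i = 0"
      using Cons.prems(1) Cons.prems(2)[of i] by auto
    have "chain v p L z = chain v p (filter (\<lambda>i. i \<in> K) L) z"
    proof (rule Cons.IH)
      show "p j = 0 \<or> (\<exists>k\<in>set L \<inter> K. p k = 1 \<and> \<not> le j k)" if "j \<in> set L" "j \<notin> K" for j
        using Cons.prems(2)[of j] that False by auto
    qed (use Cons.prems in auto)
    then show ?thesis
      using False \<open>p i = 0\<close> by (simp add: bicomb_0 v_in chain_in \<open>z \<in> Y\<close>)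
  qed
qed simp

end

text \<open>Changing the weight at stage \<open>i\<close> costs at most
  \<open>\<kappa> * (q i + \<epsilon>) * D\<close>, while the cost of later stages is damped by the
  survival factor \<open>1 - q i\<close>. The \<open>q i\<close> weighted by survival add up to at
  most 1, so the main term does not grow with the number of stages; only the \<epsilon>-errors are
  counted by \<open>length L\<close>.\<close>

lemma chain_dist:
  assumes v_in: "\<And>i. v i \<in> Y" and "z \<in> Y"
    and p: "\<And>i. 0 \<le> p i" "\<And>i. p i \<le> 1" and q: "\<And>i. 0 \<le> q i" "\<And>i. q i \<le> 1"
    and diff: "\<And>i. i \<in> set L \<Longrightarrow> \<bar>p i - q i\<bar> \<le> \<kappa> * (q i + \<epsilon>)"
    and D: "\<And>i j. i \<in> set L \<Longrightarrow> j \<in> set L \<Longrightarrow> dist (v i) (v j) \<le> D"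
           "\<And>i. i \<in> set L \<Longrightarrow> dist (v i) z \<le> D"
    and nonneg: "0 \<le> D" "0 \<le> \<kappa>" "0 \<le> \<epsilon>"
  shows "dist (chain v p L z) (chain v q L z) \<le> D * \<kappa> * (1 + \<epsilon> * length L)"
  using diff D
proof (induction L)
  case Nil
  then show ?case using nonneg by simp
next
  case (Cons i L)
  let ?x = "chain v p L z" and ?y = "chain v q L z"
  have in_Y: "?x \<in> Y" "?y \<in> Y"
    using assms by (auto intro!: chain_in)
  have "dist (v i) ?x \<le> D"
    using Cons.prems assms by (intro chain_ball) auto
  have 1: "dist (\<sigma> (v i) ?x (p i)) (\<sigma> (v i) ?x (q i)) \<le> \<bar>p i - q i\<bar> * dist (v i) ?x"
  proof (cases "p i \<le> q i")
    case True
    then show ?thesis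
      using bicomb_parameter[of "v i" ?x "p i" "q i"] in_Y v_in p q by (simp add: abs_if)
  next
    case False
    then show ?thesis
      using bicomb_parameter[of "v i" ?x "q i" "p i"] in_Y v_in p q
      by (simp add: abs_if dist_commute)
  qed
  have 2: "dist (\<sigma> (v i) ?x (q i)) (\<sigma> (v i) ?y (q i)) \<le> (1 - q i) * dist ?x ?y"
    using bicomb_conical[of "v i" ?x "v i" ?y "q i"] in_Y v_in q by simp
  have "dist (chain v p (i # L) z) (chain v q (i # L) z)
      \<le> dist (\<sigma> (v i) ?x (p i)) (\<sigma> (v i) ?x (q i)) + dist (\<sigma> (v i) ?x (q i)) (\<sigma> (v i) ?y (q i))"
    by (simp add: dist_triangle)
  also have "\<dots> \<le> \<bar>p i - q i\<bar> * dist (v i) ?x + (1 - q i) * dist ?x ?y"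
    using 1 2 by (rule add_mono)
  also have "\<dots> \<le> \<kappa> * (q i + \<epsilon>) * D + (1 - q i) * (D * \<kappa> * (1 + \<epsilon> * length L))"
  proof (intro add_mono mult_mono)
    show "dist ?x ?y \<le> D * \<kappa> * (1 + \<epsilon> * length L)"
      using Cons.prems by (intro Cons.IH) auto
  qed (use Cons.prems \<open>dist (v i) ?x \<le> D\<close> nonneg q in auto)
  \<comment> \<open>Damping removes \<open>q i * (D * \<kappa>)\<close> from the induction bound,
    exactly the main cost of this stage.\<close>
  also have "\<dots> = D * \<kappa> * (1 + \<epsilon> * length (i # L)) - q i * (D * \<kappa> * (\<epsilon> * length L))"
    by (simp add: algebra_simps)
  also have "\<dots> \<le> D * \<kappa> * (1 + \<epsilon> * length (i # L))"
    using nonneg q by simp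
  finally show ?case .
qed

end

section \<open>The exponential cutoff function\<close>

lemma clamp_growth:
  fixes M :: real
  assumes "M \<ge> 1" "a \<le> M * b" "0 \<le> b" "0 \<le> l" "0 \<le> r"
  shows "min r (max l a) \<le> M * min r (max l b)"
proof -
  have "l \<le> M * l" "r \<le> M * r"
    using assms by (simp_all add: mult_le_cancel_right1)
  then have "min r (max l a) \<le> min (M * r) (max (M * l) (M * b))"
    using assms by (intro min.mono max.mono)
  also have "\<dots> = M * min r (max l b)"
    using assms by (simp add: min_mult_distrib_left max_mult_distrib_left)
  finally show ?thesis .
qed

text \<open>\<open>h + \<epsilon>\<close> is the exponential
  \<open>\<epsilon> * exp (\<Lambda> * (2 - u))\<close> clamped between \<open>\<epsilon>\<close>
  and \<open>1 + \<epsilon>\<close>. Its relative growth rate \<open>\<Lambda>\<close> survives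
  clamping, so the change of \<open>h\<close> is proportional to \<open>h v + \<epsilon>\<close>.
  The last hypothesis says that the upper clamp is reached at \<open>u = 1\<close>.\<close>

lemma exponential_cutoff:
  fixes \<Lambda> \<epsilon> :: real
  assumes "\<epsilon> > 0" "\<Lambda> > 0" "1 + \<epsilon> \<le> \<epsilon> * exp \<Lambda>"
  obtains h :: "real \<Rightarrow> real" where
    "\<And>u. 0 \<le> h u" "\<And>u. h u \<le> 1" "\<And>u. u \<le> 1 \<Longrightarrow> h u = 1" "\<And>u. u \<ge> 2 \<Longrightarrow> h u = 0"
    "\<And>u v. \<Lambda> * \<bar>u - v\<bar> \<le> 1 \<Longrightarrow> \<bar>h u - h v\<bar> \<le> 2 * \<Lambda> * \<bar>u - v\<bar> * (h v + \<epsilon>)"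
proof
  define e where "e = (\<lambda>u. \<epsilon> * exp (\<Lambda> * (2 - u)))"
  define g where "g = (\<lambda>u. min (1 + \<epsilon>) (max \<epsilon> (e u)))"
  define h where "h = (\<lambda>u. g u - \<epsilon>)"
  show "0 \<le> h u" "h u \<le> 1" for u
    using assms by (auto simp: h_def g_def)
  show "h u = 1" if "u \<le> 1" for u
  proof -
    have "\<epsilon> * exp \<Lambda> \<le> e u"
      using that assms unfolding e_def by simp
    then show ?thesis
      using assms by (simp add: h_def g_def)
  qed
  show "h u = 0" if "u \<ge> 2" for u
  proof -
    have "e u \<le> \<epsilon>"
      using that assms unfolding e_def by (simp add: mult_le_0_iff)
    then show ?thesis
      using assms by (simp add: h_def g_def)
  qed
  have growth: "g u \<le> exp (\<Lambda> * \<bar>u - v\<bar>) * g v" for u v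
    unfolding g_def
  proof (rule clamp_growth)
    have "\<Lambda> * (2 - u) \<le> \<Lambda> * \<bar>u - v\<bar> + \<Lambda> * (2 - v)"
      using assms by (simp flip: distrib_left)
    then show "e u \<le> exp (\<Lambda> * \<bar>u - v\<bar>) * e v"
      using assms by (simp add: e_def flip: exp_add)
  qed (use assms in \<open>auto simp: e_def\<close>)
  show "\<bar>h u - h v\<bar> \<le> 2 * \<Lambda> * \<bar>u - v\<bar> * (h v + \<epsilon>)" if "\<Lambda> * \<bar>u - v\<bar> \<le> 1" for u v
  proof -
    define w where "w = \<Lambda> * \<bar>u - v\<bar>"
    have w: "0 \<le> w" "w \<le> 1"
      using that assms by (auto simp: w_def)
    \<comment> \<open>Linearising the exponential on the unit interval is the source of the factor 2
      in the estimate.\<close>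
    have "exp w \<le> 1 + w + w\<^sup>2"
      using w by (intro exp_bound)
    also have "\<dots> \<le> 1 + 2 * w"
      using w by (simp add: power2_eq_square mult_left_le)
    finally have ew: "exp w \<le> 1 + 2 * w" .
    have "0 \<le> g u" "0 \<le> g v"
      using assms by (auto simp: g_def)
    have "g u \<le> (1 + 2 * w) * g v"
      using growth[of u v] mult_right_mono[OF ew \<open>0 \<le> g v\<close>] by (simp add: w_def)
    moreover have "(1 - w) * g v \<le> g u"
    proof -
      have "(1 - w) * g v \<le> exp (- w) * g v"
        using exp_ge_add_one_self[of "- w"] \<open>0 \<le> g v\<close> by (intro mult_right_mono) auto
      also have "\<dots> \<le> exp (- w) * (exp w * g u)"
        using growth[of v u] by (simp add: w_def abs_minus_commute)
      also have "\<dots> = g u"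
        by (simp flip: mult.assoc exp_add)
      finally show ?thesis .
    qed
    moreover have "0 \<le> w * g v"
      using w \<open>0 \<le> g v\<close> by simp
    ultimately have "\<bar>g u - g v\<bar> \<le> 2 * w * g v"
      by (simp add: algebra_simps abs_le_iff)
    then show ?thesis
      by (simp add: h_def w_def mult.assoc)
  qed
qed

section \<open>Linear orders for the pairs of level and covering set\<close>

lemma linorder_exists: "\<exists>le lt :: 'a \<Rightarrow> 'a \<Rightarrow> bool. class.linorder le lt"
proof -
  obtain r :: "'a rel" where r: "Well_order r \<and> Field r = UNIV"
    using well_ordering ..
  define le where "le = (\<lambda>x y. (x, y) \<in> r)"
  have le: "le x x" "le x y \<or> le y x" "le x y \<Longrightarrow> le y z \<Longrightarrow> le x z" "le x y \<Longrightarrow> le y x \<Longrightarrow> x = y"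
    for x y z
  proof -
    have *: "refl r" "trans r" "antisym r" "total r"
      using r unfolding order_on_defs by metis+
    show "le x x"
      using *(1) by (simp add: le_def refl_on_def)
    then show "le x y \<or> le y x"
      using *(4) unfolding le_def total_on_def by (metis UNIV_I)
    show "le x y \<Longrightarrow> le y z \<Longrightarrow> le x z"
      using *(2) unfolding le_def by (rule transD)
    show "le x y \<Longrightarrow> le y x \<Longrightarrow> x = y"
      using *(3) unfolding le_def by (rule antisymD)
  qed
  have "class.linorder le (\<lambda>x y. le x y \<and> \<not> le y x)"
    by unfold_locales (fact refl le)+
  then show ?thesis by blast
qed

text \<open>Lexicographic order. Inside a level the order is arbitrary but fixed once for all
  points, since the chains of two points are compared along a common sorted list.\<close>

lemma linorder_refining_fst:
  "\<exists>le lt :: 'l::linorder \<times> 'a \<Rightarrow> 'l \<times> 'a \<Rightarrow> bool.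
     class.linorder le lt \<and> (\<forall>i k. fst k < fst i \<longrightarrow> \<not> le i k)"
proof -
  obtain le0 lt0 :: "'a \<Rightarrow> 'a \<Rightarrow> bool" where "class.linorder le0 lt0"
    using linorder_exists by blast
  then interpret O: linorder le0 lt0 .
  define le :: "'l \<times> 'a \<Rightarrow> 'l \<times> 'a \<Rightarrow> bool" where
    "le = (\<lambda>i k. fst i < fst k \<or> fst i = fst k \<and> le0 (snd i) (snd k))"
  have le: "le x x" "le x y \<or> le y x" "le x y \<Longrightarrow> le y z \<Longrightarrow> le x z" "le x y \<Longrightarrow> le y x \<Longrightarrow> x = y"
    for x y z
    using O.linear[of "snd x" "snd y"] O.order_trans[of "snd x" "snd y" "snd z"]
      O.order_antisym[of "snd x" "snd y"]
    by (auto simp: le_def prod_eq_iff)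
  have "class.linorder le (\<lambda>x y. le x y \<and> \<not> le y x)"
    by unfold_locales (fact refl le)+
  moreover have "\<forall>i k. fst k < fst i \<longrightarrow> \<not> le i k"
    by (auto simp: le_def)
  ultimately show ?thesis by blast
qed

section \<open>Dyadic Nagata coverings\<close>

lemma infdist_lessE:
  assumes "infdist x B < r" "B \<noteq> {}"
  obtains b where "b \<in> B" "dist x b < r"
proof -
  have "(INF b\<in>B. dist x b) < r"
    using assms by (simp add: infdist_notempty)
  then have "\<exists>b\<in>B. dist x b < r"
    using assms(2) by (subst (asm) cINF_less_iff) auto
  then show ?thesis
    using that by blast
qed

lemma diameter_leI:
  fixes D :: "'a::metric_space set"
  assumes "0 \<le> d" "\<And>y z. y \<in> D \<Longrightarrow> z \<in> D \<Longrightarrow> dist y z \<le> d"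
  shows "diameter D \<le> d"
  unfolding diameter_def using assms by (auto intro!: cSUP_least)

text \<open>Non-empty members closer than \<open>2 * r\<close> to \<open>x\<close> meet
  \<open>A \<inter> ball x (2 * r)\<close>, whose diameter is at most \<open>4 * r\<close>; the
  scale \<open>5 * r\<close> supplies the strict inequality in the multiplicity condition. The empty
  set is removed because \<open>infdist x {} = 0\<close> would count it as near every point.\<close>

lemma Nagata_cover:
  fixes A :: "'a::metric_space set"
  assumes "Nagata n c A" "r > 0"
  shows "\<exists>\<C>. \<Union>\<C> = A \<and> {} \<notin> \<C> \<and>
    (\<forall>x. finite {B\<in>\<C>. infdist x B < 2 * r} \<and> card {B\<in>\<C>. infdist x B < 2 * r} \<le> n + 1) \<and>
    (\<forall>B\<in>\<C>. \<forall>a\<in>B. \<forall>b\<in>B. dist a b \<le> 5 * c * r)"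
proof -
  obtain \<C> where \<C>: "covering A \<C>" "multiplicity_at_most A (5 * r) (n + 1) \<C>"
      "\<forall>B\<in>\<C>. bounded B \<and> diameter B \<le> c * (5 * r)"
    using assms unfolding Nagata_def by (meson mult_pos_pos zero_less_numeral)
  have "finite {B\<in>\<C> - {{}}. infdist x B < 2 * r} \<and> card {B\<in>\<C> - {{}}. infdist x B < 2 * r} \<le> n + 1"
    for x
  proof -
    define D where "D = A \<inter> ball x (2 * r)"
    have "dist y z \<le> 4 * r" if "y \<in> D" "z \<in> D" for y z
      using that dist_triangle[of y z x] by (auto simp: D_def dist_commute)
    then have "diameter D \<le> 4 * r"
      using assms(2) by (intro diameter_leI) auto
    moreover have "bounded D" "D \<subseteq> A"
      by (auto simp: D_def bounded_Int)
    ultimately have fin: "finite {B\<in>\<C>. B \<inter> D \<noteq> {}}" "card {B\<in>\<C>. B \<inter> D \<noteq> {}} \<le> n + 1"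
      using \<C>(2) assms(2) unfolding multiplicity_at_most_def by auto
    have "{B\<in>\<C> - {{}}. infdist x B < 2 * r} \<subseteq> {B\<in>\<C>. B \<inter> D \<noteq> {}}"
    proof
      fix B assume B: "B \<in> {B\<in>\<C> - {{}}. infdist x B < 2 * r}"
      then obtain b where "b \<in> B" "dist x b < 2 * r"
        using infdist_lessE[of x B "2 * r"] by blast
      moreover have "B \<subseteq> A"
        using B \<C>(1) unfolding covering_def by blast
      ultimately have "b \<in> B \<inter> D"
        by (auto simp: D_def)
      then show "B \<in> {B\<in>\<C>. B \<inter> D \<noteq> {}}"
        using B by blast
    qed
    then show ?thesis
      using fin by (meson card_mono finite_subset le_trans)
  qed
  moreover have "dist a b \<le> 5 * c * r" if "B \<in> \<C>" "a \<in> B" "b \<in> B" for B a b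
    using \<C>(3) diameter_bounded_bound[of B a b] that by fastforce
  moreover have "\<Union>(\<C> - {{}}) = A"
    using \<C>(1) unfolding covering_def by auto
  ultimately show ?thesis
    by (intro exI[of _ "\<C> - {{}}"]) auto
qed

locale dyadic_covers =
  fixes A :: "'a::metric_space set" and n :: nat and c :: real and C :: "int \<Rightarrow> 'a set set"
  assumes A_nonempty: "A \<noteq> {}" and c_pos: "c > 0"
    and cover: "\<Union>(C j) = A"
    and nonempty: "{} \<notin> C j"
    and finite_near: "finite {B\<in>C j. infdist x B < 2 * 2 powr j}"
    and card_near: "card {B\<in>C j. infdist x B < 2 * 2 powr j} \<le> n + 1"
    and diam: "B \<in> C j \<Longrightarrow> a \<in> B \<Longrightarrow> b \<in> B \<Longrightarrow> dist a b \<le> 5 * c * 2 powr j"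
begin

text \<open>At positive distance from \<open>A\<close>, the least \<open>j\<close> with
  \<open>infdist x A < 2 powr j\<close>, so that some covering set of this level is sure to lie
  where the cutoff equals 1.\<close>

definition level :: "'a \<Rightarrow> int" where
  "level x = \<lfloor>log 2 (infdist x A)\<rfloor> + 1"

text \<open>The bound on \<open>j\<close> discards the levels after the sure stop; the bound on
  \<open>infdist x B\<close> discards pairs whose cutoff is zero.\<close>

definition active :: "'a \<Rightarrow> (int \<times> 'a set) set" where
  "active x = {(j, B). j \<le> level x \<and> B \<in> C j \<and> infdist x B < 2 * 2 powr j}"

lemma infdist_cover_ge: "B \<in> C j \<Longrightarrow> infdist x A \<le> infdist x B"
  using cover nonempty by (intro infdist_mono) auto

lemma level_bounds:
  assumes "infdist x A > 0"
  shows "infdist x A < 2 powr level x" "2 powr level x \<le> 2 * infdist x A"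
proof -
  let ?t = "infdist x A"
  have "log 2 ?t < level x" "level x - 1 \<le> log 2 ?t"
    unfolding level_def by linarith+
  then show "?t < 2 powr level x" and "2 powr level x \<le> 2 * ?t"
    using assms by (auto simp: log_less_iff le_log_iff powr_diff)
qed

lemma active_scale: "i \<in> active x \<Longrightarrow> infdist x A < 2 * 2 powr real_of_int (fst i)"
  by (auto simp: active_def dest: infdist_cover_ge[of _ _ x])

lemma active_subset:
  assumes "infdist x A > 0"
  shows "active x \<subseteq> (\<Union>j\<in>{level x - 1, level x}. Pair j ` {B\<in>C j. infdist x B < 2 * 2 powr j})"
proof clarify
  fix j B assume i: "(j, B) \<in> active x"
  \<comment> \<open>\<open>2 powr level x\<close> is at most twice the distance to \<open>A\<close>,
    which is below \<open>2 * 2 powr j\<close>. Only two levels survive, hence the later count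
    \<open>2 * (n + 1)\<close>.\<close>
  have "2 powr level x < 2 powr (j + 2)"
    using active_scale[OF i] level_bounds[OF assms] by (simp add: powr_add)
  then have "level x < j + 2"
    by (simp flip: of_int_add)
  then have "j = level x - 1 \<or> j = level x"
    using i by (auto simp: active_def)
  then show "(j, B) \<in> (\<Union>j\<in>{level x - 1, level x}. Pair j ` {B\<in>C j. infdist x B < 2 * 2 powr j})"
    using i by (auto simp: active_def)
qed

lemma active_finite:
  assumes "infdist x A > 0"
  shows "finite (active x)"
  using finite_near by (intro finite_subset[OF active_subset[OF assms]]) blast

lemma active_card:
  assumes "infdist x A > 0"
  shows "card (active x) \<le> 2 * (n + 1)"
proof -
  let ?N = "\<lambda>j. Pair j ` {B\<in>C j. infdist x B < 2 * 2 powr j}"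
  have N: "finite (?N j)" "card (?N j) \<le> n + 1" for j
    using finite_near card_near by (auto intro: card_image_le[THEN order_trans])
  have "card (active x) \<le> card (?N (level x - 1) \<union> ?N (level x))"
    using active_subset[OF assms] N(1) by (intro card_mono finite_UnI) (simp only: UN_insert UN_empty Un_empty_right)+
  also have "\<dots> \<le> card (?N (level x - 1)) + card (?N (level x))"
    by (rule card_Un_le)
  also have "\<dots> \<le> 2 * (n + 1)"
    unfolding mult_2[of "n + 1"] by (intro add_mono N(2))
  finally show ?thesis .
qed

lemma active_dist:
  assumes "infdist x A > 0" "(j, B) \<in> active x" "b \<in> B"
  shows "dist x b \<le> (4 + 10 * c) * infdist x A"
proof -
  have B: "j \<le> level x" "B \<in> C j" "infdist x B < 2 * 2 powr j"
    using assms(2) by (auto simp: active_def)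
  obtain a where a: "a \<in> B" "dist x a < 2 * 2 powr j"
    using infdist_lessE[OF B(3)] assms(3) by blast
  have "dist x b \<le> dist x a + dist a b"
    by (rule dist_triangle)
  also have "\<dots> \<le> (2 + 5 * c) * 2 powr j"
    using a diam[OF B(2) a(1) assms(3)] by (simp add: algebra_simps)
  also have "\<dots> \<le> (2 + 5 * c) * (2 * infdist x A)"
  proof (rule mult_left_mono)
    have "2 powr j \<le> 2 powr level x"
      using B(1) by simp
    then show "2 powr j \<le> 2 * infdist x A"
      using level_bounds[OF assms(1)] by linarith
  qed (use c_pos in simp)
  finally show ?thesis by (simp add: algebra_simps)
qed

text \<open>By the choice of the level, some point of \<open>A\<close> is closer than
  \<open>2 powr level x\<close>; the covering set containing it provides the sure stop.\<close>

lemma active_top: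
  assumes "infdist x A > 0"
  obtains B where "(level x, B) \<in> active x" "infdist x B \<le> 2 powr level x"
proof -
  obtain a where a: "a \<in> A" "dist x a < 2 powr level x"
    using level_bounds(1)[OF assms] A_nonempty by (rule infdist_lessE)
  then obtain B where B: "B \<in> C (level x)" "a \<in> B"
    using cover by blast
  then have "infdist x B \<le> 2 powr level x"
    using a infdist_le[of a B x] by linarith
  moreover have "0 < (2::real) powr level x"
    by simp
  ultimately have "infdist x B < 2 * 2 powr level x"
    by linarith
  then show ?thesis
    using that B \<open>infdist x B \<le> 2 powr level x\<close> by (auto simp: active_def)
qed

end

section \<open>The extension\<close>

lemma lipschitz_extension_to_closure:
  fixes F :: "'a::metric_space \<Rightarrow> 'b::metric_space"
  assumes lip: "L-lipschitz_on S F" and "F ` S \<subseteq> Y" "complete Y" "X \<subseteq> closure S"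
  shows "\<exists>G. G ` X \<subseteq> Y \<and> (\<forall>x\<in>S. G x = F x) \<and> L-lipschitz_on X G"
proof -
  have "\<exists>s. (\<forall>k. s k \<in> S) \<and> s \<longlonglongrightarrow> x" if "x \<in> X" for x
    using assms(4) that closure_sequential by blast
  then obtain s where s: "\<And>x k. x \<in> X \<Longrightarrow> s x k \<in> S" "\<And>x. x \<in> X \<Longrightarrow> s x \<longlonglongrightarrow> x"
    by metis
  have "\<exists>l\<in>Y. (F \<circ> s x) \<longlonglongrightarrow> l" if "x \<in> X" for x
  proof -
    have "Cauchy (F \<circ> s x)"
      using uniformly_continuous_on_Cauchy[OF lipschitz_on_uniformly_continuous[OF lip]]
        LIMSEQ_imp_Cauchy[OF s(2)[OF that]] s(1)[OF that] by (simp add: o_def)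
    then show ?thesis
      using completeE[OF assms(3), of "F \<circ> s x"] s(1)[OF that] assms(2) by (metis comp_apply image_subset_iff)
  qed
  then obtain l where l: "\<And>x. x \<in> X \<Longrightarrow> l x \<in> Y" "\<And>x. x \<in> X \<Longrightarrow> (F \<circ> s x) \<longlonglongrightarrow> l x"
    by metis
  define G where "G = (\<lambda>x. if x \<in> S then F x else l x)"
  \<comment> \<open>Points of \<open>S\<close> get a constant sequence, so that \<open>G\<close>
    keeps the values of \<open>F\<close> there and one limit argument serves all points of
    \<open>X\<close>.\<close>
  have "\<exists>t. (\<forall>k. t k \<in> S) \<and> t \<longlonglongrightarrow> x \<and> (F \<circ> t) \<longlonglongrightarrow> G x" if "x \<in> X" for x
  proof (cases "x \<in> S")
    case True
    then show ?thesis
      by (intro exI[of _ "\<lambda>_. x"]) (simp add: G_def o_def)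
  next
    case False
    then show ?thesis
      using s[OF that] l[OF that] by (intro exI[of _ "s x"]) (simp add: G_def)
  qed
  then obtain t where t: "\<And>x k. x \<in> X \<Longrightarrow> t x k \<in> S" "\<And>x. x \<in> X \<Longrightarrow> t x \<longlonglongrightarrow> x"
      "\<And>x. x \<in> X \<Longrightarrow> (F \<circ> t x) \<longlonglongrightarrow> G x"
    by metis
  have "L-lipschitz_on X G"
  proof (rule lipschitz_onI)
    fix x y assume xy: "x \<in> X" "y \<in> X"
    show "dist (G x) (G y) \<le> L * dist x y"
    proof (rule tendsto_le[OF sequentially_bot])
      show "(\<lambda>k. L * dist (t x k) (t y k)) \<longlonglongrightarrow> L * dist x y"
        using t xy by (intro tendsto_intros)
      show "(\<lambda>k. dist ((F \<circ> t x) k) ((F \<circ> t y) k)) \<longlonglongrightarrow> dist (G x) (G y)"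
        using t xy by (intro tendsto_intros)
    qed (use t(1) xy lipschitz_onD[OF lip] in auto)
  qed (rule lipschitz_on_nonneg[OF lip])
  moreover have "G ` X \<subseteq> Y"
    using l(1) assms(2) by (auto simp: G_def)
  ultimately show ?thesis
    by (intro exI[of _ G]) (simp add: G_def)
qed

section \<open>Whitney-type extension to \<open>A\<close> and the points at positive distance from
  it\<close>

locale whitney_extension = dyadic_covers A n c C + conical_bicombing Y \<sigma>
  for A :: "'a::metric_space set" and n c C and Y :: "'b::metric_space set" and \<sigma> +
  fixes f :: "'a \<Rightarrow> 'b"
  assumes f_in: "f ` A \<subseteq> Y" and f_lip: "1-lipschitz_on A f"
begin

lemma f_dist: "a \<in> A \<Longrightarrow> b \<in> A \<Longrightarrow> dist (f a) (f b) \<le> dist a b"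
  using lipschitz_onD[OF f_lip, of a b] by simp

lemma extension_off_boundary:
  "\<exists>F. F ` (A \<union> {x. infdist x A > 0}) \<subseteq> Y \<and> (\<forall>x\<in>A. F x = f x) \<and>
     (1000 * (c + 1) * log 2 (real n + 2))-lipschitz_on (A \<union> {x. infdist x A > 0}) F"
proof -
  define \<l> where "\<l> = log 2 (real n + 2)"
  \<comment> \<open>The factor 3 gives \<open>exp \<Lambda> \<ge> (n + 2)^3 \<ge> 4 * n + 5 = (1 +
    \<epsilon>) / \<epsilon>\<close>, as the cutoff requires.\<close>
  define \<Lambda> where "\<Lambda> = 3 * \<l>"
  \<comment> \<open>At most \<open>4 * (n + 1)\<close> pairs are active at one of two given points,
    so the \<epsilon>-errors of a chain add up to at most 1.\<close>
  define \<epsilon> where "\<epsilon> = 1 / (4 * (real n + 1))"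
  have \<l>: "\<l> \<ge> 1"
    by (simp add: \<l>_def le_log_iff)
  have "\<epsilon> > 0"
    by (simp add: \<epsilon>_def)
  have "1 + \<epsilon> \<le> \<epsilon> * exp \<Lambda>"
  proof -
    have "4 * real n + 5 \<le> (real n + 2) ^ 3"
      by (simp add: power3_eq_cube algebra_simps)
    also have "\<dots> = exp (3 * ln (real n + 2))"
      by (simp add: exp_of_nat_mult[of 3, simplified])
    also have "\<dots> \<le> exp \<Lambda>"
      using ln_2_less_1 by (simp add: \<Lambda>_def \<l>_def log_def field_simps mult_left_le)
    finally have "\<epsilon> * (4 * real n + 5) \<le> \<epsilon> * exp \<Lambda>"
      using \<open>\<epsilon> > 0\<close> by simp
    moreover have "1 + \<epsilon> = \<epsilon> * (4 * real n + 5)"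
      by (simp add: \<epsilon>_def field_simps)
    ultimately show ?thesis by simp
  qed
  with \<open>\<epsilon> > 0\<close> \<l> obtain h :: "real \<Rightarrow> real" where
    h01: "\<And>u. 0 \<le> h u" "\<And>u. h u \<le> 1"
    and h1: "\<And>u. u \<le> 1 \<Longrightarrow> h u = 1" and h0: "\<And>u. u \<ge> 2 \<Longrightarrow> h u = 0"
    and h_diff: "\<And>u v. \<Lambda> * \<bar>u - v\<bar> \<le> 1 \<Longrightarrow> \<bar>h u - h v\<bar> \<le> 2 * \<Lambda> * \<bar>u - v\<bar> * (h v + \<epsilon>)"
    using exponential_cutoff[of \<epsilon> \<Lambda>] unfolding \<Lambda>_def by (smt (verit))
  obtain le lt :: "int \<times> 'a set \<Rightarrow> int \<times> 'a set \<Rightarrow> bool"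
    where "class.linorder le lt" and le_fst: "\<And>i k. fst k < fst i \<Longrightarrow> \<not> le i k"
    using linorder_refining_fst by metis
  interpret O: linorder le lt by fact
  obtain a0 where "a0 \<in> A"
    using A_nonempty by blast
  \<comment> \<open>The default \<open>a0\<close> puts \<open>v i\<close> into \<open>Y\<close> for
    every index \<open>i\<close>, as the chain lemmas demand.\<close>
  define b where "b = (\<lambda>i::int \<times> 'a set. if snd i \<subseteq> A \<and> snd i \<noteq> {} then SOME b. b \<in> snd i else a0)"
  define v where "v = (\<lambda>i. f (b i))"
  define p where "p = (\<lambda>x (i::int \<times> 'a set). h (infdist x (snd i) / 2 powr real_of_int (fst i)))"
  define F where "F = (\<lambda>x. if x \<in> A then f x else
    chain v (p x) (O.sorted_list_of_set (active x)) (f a0))"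
  have b_in: "b i \<in> A" for i
    using \<open>a0 \<in> A\<close> some_in_eq[of "snd i"] by (auto simp: b_def)
  then have v_in: "v i \<in> Y" for i
    using f_in unfolding v_def by blast
  have p01: "0 \<le> p x i" "p x i \<le> 1" for x i
    using h01 by (auto simp: p_def)
  note chain_facts = v_in p01
  have b_dist: "dist x (b i) \<le> (4 + 10 * c) * infdist x A" if "infdist x A > 0" "i \<in> active x" for x i
  proof -
    have i: "snd i \<in> C (fst i)"
      using that(2) by (auto simp: active_def)
    then have "snd i \<subseteq> A" "snd i \<noteq> {}"
      using cover nonempty by auto
    then have "b i \<in> snd i"
      by (simp add: b_def some_in_eq)
    then show ?thesis
      using active_dist[of x "fst i" "snd i"] that by simp
  qed
  have sure: "\<exists>k\<in>active x. fst k = level x \<and> p x k = 1" if x: "infdist x A > 0" for x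
  proof -
    obtain B where "(level x, B) \<in> active x" "infdist x B \<le> 2 powr level x"
      using x by (rule active_top)
    then show ?thesis
      by (intro bexI[of _ "(level x, B)"]) (auto simp: p_def intro!: h1)
  qed
  have F_eq: "F x = chain v (p x) (O.sorted_list_of_set (active x)) z"
    if "infdist x A > 0" "z \<in> Y" for x z
  proof -
    have "x \<notin> A"
      using that by auto
    then have "F x = chain v (p x) (O.sorted_list_of_set (active x)) (f a0)"
      by (simp add: F_def)
    also have "\<dots> = chain v (p x) (O.sorted_list_of_set (active x)) z"
    proof (rule chain_base_irrelevant)
      show "\<exists>k\<in>set (O.sorted_list_of_set (active x)). p x k = 1"
        using sure[OF that(1)] active_finite[OF that(1)] by auto
    qed (use f_in \<open>a0 \<in> A\<close> that chain_facts in auto)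
    finally show ?thesis .
  qed
  \<comment> \<open>Pairs active only at \<open>y\<close> do not affect \<open>F x\<close>: up to
    \<open>level x\<close> their cutoff at \<open>x\<close> is zero, and beyond it they come after
    the sure stop. Hence \<open>F x\<close> and \<open>F y\<close> can be computed along the same
    list.\<close>
  have F_union: "F x = chain v (p x) (O.sorted_list_of_set (active x \<union> active y)) z"
    if x: "infdist x A > 0" and y: "infdist y A > 0" and z: "z \<in> Y" for x y z
  proof -
    let ?L = "O.sorted_list_of_set (active x \<union> active y)"
    have fin: "finite (active x)" "finite (active x \<union> active y)"
      using active_finite x y by auto
    have "chain v (p x) ?L z = chain v (p x) (filter (\<lambda>i. i \<in> active x) ?L) z"
    proof (rule chain_filter)
      show "sorted_wrt le ?L"
        by (rule O.sorted_sorted_list_of_set)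
      fix i assume i: "i \<in> set ?L" "i \<notin> active x"
      show "p x i = 0 \<or> (\<exists>k\<in>set ?L \<inter> active x. p x k = 1 \<and> \<not> le i k)"
      proof (cases "fst i \<le> level x")
        case True
        have "snd i \<in> C (fst i)"
          using i fin by (auto simp: active_def)
        then have "infdist x (snd i) \<ge> 2 * 2 powr fst i"
          using i(2) True by (auto simp: active_def not_less)
        then have "p x i = 0"
          unfolding p_def by (intro h0) (simp add: field_simps)
        then show ?thesis ..
      next
        case False
        then show ?thesis
          using sure[OF x] fin le_fst[of _ i] by fastforce
      qed
    qed (use z chain_facts in auto)
    also have "filter (\<lambda>i. i \<in> active x) ?L = O.sorted_list_of_set (active x)"
    proof (rule O.sorted_distinct_set_unique)
      show "sorted_wrt le (filter (\<lambda>i. i \<in> active x) ?L)"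
        by (intro sorted_wrt_filter O.sorted_sorted_list_of_set)
    qed (use fin in auto)
    finally show ?thesis
      using F_eq[OF x z] by simp
  qed
  have F_in: "F x \<in> Y" if "x \<in> A \<or> infdist x A > 0" for x
  proof (cases "x \<in> A")
    case True
    then show ?thesis using f_in by (auto simp: F_def)
  next
    case False
    then have x: "infdist x A > 0" using that by blast
    show ?thesis
      unfolding F_eq[OF x v_in[of undefined]] by (intro chain_in chain_facts)
  qed
  have F_ball: "dist w (F x) \<le> R"
    if x: "infdist x A > 0" and w: "w \<in> Y" and R: "\<And>i. i \<in> active x \<Longrightarrow> dist w (v i) \<le> R" for x w R
  proof -
    \<comment> \<open>Taking the value of an active index as base point places the base in the ball
      as well.\<close>
    obtain k where "k \<in> active x"
      using sure[OF x] by blast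
    then show ?thesis
      unfolding F_eq[OF x v_in[of k]]
      using R active_finite[OF x] by (intro chain_ball chain_facts w) auto
  qed
  have bound_A: "dist (F a) (F x) \<le> 1000 * (c + 1) * \<l> * dist a x"
    if a: "a \<in> A" and x: "infdist x A > 0" for a x
  proof -
    have t: "infdist x A \<le> dist a x"
      using infdist_le[OF a, of x] by (simp add: dist_commute)
    \<comment> \<open>All values combined in \<open>F x\<close> lie within this radius of
      \<open>f a\<close>, so convexity of balls suffices.\<close>
    have "dist (F a) (F x) \<le> (4 + 10 * c) * dist a x + dist a x"
    proof (rule F_ball[OF x F_in])
      fix i assume i: "i \<in> active x"
      have "dist (F a) (v i) \<le> dist a (b i)"
        using a b_in by (simp add: F_def v_def f_dist)
      also have "\<dots> \<le> dist a x + dist x (b i)"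
        by (rule dist_triangle)
      also have "dist x (b i) \<le> (4 + 10 * c) * dist a x"
        using order_trans[OF b_dist[OF x i] mult_left_mono[OF t]] c_pos by simp
      finally show "dist (F a) (v i) \<le> (4 + 10 * c) * dist a x + dist a x"
        by simp
    qed (use a in simp)
    also have "\<dots> = (5 + 10 * c) * dist a x"
      by (simp add: algebra_simps)
    also have "\<dots> \<le> (1000 * (c + 1) * \<l>) * dist a x"
    proof (rule mult_right_mono)
      have "5 + 10 * c \<le> 1000 * (c + 1) * 1"
        using c_pos by simp
      also have "\<dots> \<le> 1000 * (c + 1) * \<l>"
        using \<l> c_pos by (intro mult_left_mono) auto
      finally show "5 + 10 * c \<le> 1000 * (c + 1) * \<l>" .
    qed simp
    finally show ?thesis .
  qed
  have bound_off: "dist (F x) (F y) \<le> 1000 * (c + 1) * \<l> * dist x y"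
    if x: "infdist x A > 0" and y: "infdist y A > 0" for x y
  proof -
    define \<delta> where "\<delta> = dist x y"
    define \<tau> where "\<tau> = min (infdist x A) (infdist y A)"
    define D where "D = (4 + 10 * c) * 2 * (\<tau> + \<delta>) + \<delta>"
    have "\<tau> > 0" "\<delta> \<ge> 0"
      using x y by (auto simp: \<tau>_def \<delta>_def)
    have max: "infdist x A \<le> \<tau> + \<delta>" "infdist y A \<le> \<tau> + \<delta>"
      using infdist_triangle[of x A y] infdist_triangle[of y A x]
      by (auto simp: \<tau>_def \<delta>_def dist_commute min_def)
    have "D \<ge> 0"
      using c_pos \<open>\<tau> > 0\<close> \<open>\<delta> \<ge> 0\<close> by (simp add: D_def)
    let ?I = "active x \<union> active y"
    have b_near: "\<exists>w\<in>{x, y}. dist w (b i) \<le> (4 + 10 * c) * (\<tau> + \<delta>)" if "i \<in> ?I" for i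
    proof -
      have "\<exists>w\<in>{x, y}. dist w (b i) \<le> (4 + 10 * c) * infdist w A"
        using that b_dist[OF x, of i] b_dist[OF y, of i] by auto
      moreover have "(4 + 10 * c) * infdist w A \<le> (4 + 10 * c) * (\<tau> + \<delta>)" if "w \<in> {x, y}" for w
        using that max c_pos by (intro mult_left_mono) auto
      ultimately show ?thesis
        by (meson order_trans)
    qed
    have v_dist: "dist (v i) (v j) \<le> D" if ij: "i \<in> ?I" "j \<in> ?I" for i j
    proof -
      obtain w w' where w: "w \<in> {x, y}" "dist w (b i) \<le> (4 + 10 * c) * (\<tau> + \<delta>)"
          "w' \<in> {x, y}" "dist w' (b j) \<le> (4 + 10 * c) * (\<tau> + \<delta>)"
        using b_near[OF ij(1)] b_near[OF ij(2)] by metis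
      have "dist w w' \<le> \<delta>"
        using w by (auto simp: \<delta>_def dist_commute)
      have "dist (v i) (v j) \<le> dist (b i) (b j)"
        by (simp add: v_def f_dist b_in)
      also have "\<dots> \<le> dist w (b i) + dist w w' + dist w' (b j)"
        using dist_triangle[of "b i" "b j" w] dist_triangle[of w "b j" w'] by (simp add: dist_commute)
      also have "\<dots> \<le> (4 + 10 * c) * (\<tau> + \<delta>) + \<delta> + (4 + 10 * c) * (\<tau> + \<delta>)"
        using w \<open>dist w w' \<le> \<delta>\<close> by (intro add_mono)
      also have "\<dots> = D"
        by (simp add: D_def algebra_simps)
      finally show ?thesis .
    qed
    \<comment> \<open>The cutoff arguments at \<open>x\<close> and \<open>y\<close> differ by at
      most \<open>2 * \<delta> / \<tau>\<close>, so the threshold is the smallness needed for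
      \<open>h_diff\<close>. If it fails, \<open>\<tau>\<close> is below
      \<open>6 * \<l> * \<delta>\<close> and the crude bound \<open>D\<close> on the spread of the
      values is enough.\<close>
    show ?thesis
    proof (cases "2 * \<Lambda> * \<delta> \<le> \<tau>")
      case False
      have "dist (F y) (F x) \<le> D"
      proof (rule F_ball[OF x F_in])
        fix i assume i: "i \<in> active x"
        have "dist (v i) (F y) \<le> D"
          using i by (intro F_ball[OF y v_in] v_dist) auto
        then show "dist (F y) (v i) \<le> D" by (simp add: dist_commute)
      qed (use y in simp)
      also have "D \<le> (4 + 10 * c) * 2 * (7 * \<l> * \<delta>) + \<l> * \<delta>"
      proof -
        have "\<delta> \<le> \<l> * \<delta>"
          using \<l> \<open>\<delta> \<ge> 0\<close> by (simp add: mult_le_cancel_right1)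
        moreover have "\<tau> + \<delta> \<le> 7 * \<l> * \<delta>"
          using False \<open>\<delta> \<le> \<l> * \<delta>\<close> by (simp add: \<Lambda>_def)
        ultimately show ?thesis
          using c_pos unfolding D_def by (intro add_mono mult_left_mono) auto
      qed
      also have "\<dots> = (57 + 140 * c) * (\<l> * \<delta>)"
        by (simp add: algebra_simps)
      also have "\<dots> \<le> (1000 * (c + 1)) * (\<l> * \<delta>)"
        using c_pos \<l> \<open>\<delta> \<ge> 0\<close> by (intro mult_right_mono) auto
      finally show ?thesis
        by (simp add: \<delta>_def dist_commute mult.assoc)
    next
      case True
      \<comment> \<open>The factor \<open>2 * \<Lambda>\<close> from \<open>h_diff\<close> times the
        largest change \<open>2 * \<delta> / \<tau>\<close> of the cutoff argument.\<close>
      define \<kappa> where "\<kappa> = 4 * \<Lambda> * \<delta> / \<tau>"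
      let ?L = "O.sorted_list_of_set ?I"
      have fin: "finite ?I"
        using active_finite x y by simp
      obtain k where k: "k \<in> active x"
        using sure[OF x] by blast
      have "\<kappa> \<ge> 0"
        using \<l> \<open>\<tau> > 0\<close> \<open>\<delta> \<ge> 0\<close> by (simp add: \<kappa>_def \<Lambda>_def)
      have "dist (F x) (F y) = dist (chain v (p x) ?L (v k)) (chain v (p y) ?L (v k))"
        using F_union[OF x y v_in[of k]] F_union[OF y x v_in[of k]] by (simp add: Un_commute)
      also have "\<dots> \<le> D * \<kappa> * (1 + \<epsilon> * length ?L)"
      proof (rule chain_dist)
        fix i assume "i \<in> set ?L"
        then have i: "i \<in> ?I"
          using fin by simp
        then show "dist (v i) (v k) \<le> D"
          using v_dist k by blast
        show "dist (v i) (v j) \<le> D" if "j \<in> set ?L" for j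
          using v_dist i that fin by simp
        let ?r = "2 powr real_of_int (fst i)"
        define u where "u = infdist x (snd i) / ?r"
        define u' where "u' = infdist y (snd i) / ?r"
        \<comment> \<open>The pair is active at \<open>x\<close> or \<open>y\<close>, so its scale
          exceeds half the distance of that point to \<open>A\<close>; this trades the scale for
          \<open>\<tau>\<close>.\<close>
        have r: "\<tau> < 2 * ?r"
          using i active_scale[of i x] active_scale[of i y] by (auto simp: \<tau>_def)
        have "\<bar>u - u'\<bar> = \<bar>infdist x (snd i) - infdist y (snd i)\<bar> / ?r"
          by (simp add: u_def u'_def flip: diff_divide_distrib)
        also have "\<dots> \<le> \<delta> / ?r"
          unfolding \<delta>_def by (intro divide_right_mono infdist_triangle_abs) simp
        also have "\<dots> \<le> \<delta> / (\<tau> / 2)"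
          using r \<open>\<tau> > 0\<close> \<open>\<delta> \<ge> 0\<close> by (intro divide_left_mono) auto
        finally have uu': "\<Lambda> * \<bar>u - u'\<bar> \<le> \<Lambda> * (2 * \<delta> / \<tau>)"
          using \<l> by (intro mult_left_mono) (auto simp: \<Lambda>_def mult.commute)
        also have "\<dots> \<le> 1"
          using True \<open>\<tau> > 0\<close> by (simp add: field_simps)
        finally have "\<bar>h u - h u'\<bar> \<le> 2 * (\<Lambda> * \<bar>u - u'\<bar>) * (h u' + \<epsilon>)"
          using h_diff[of u u'] by (simp add: mult.assoc)
        also have "\<dots> \<le> 2 * (\<Lambda> * (2 * \<delta> / \<tau>)) * (h u' + \<epsilon>)"
          using uu' h01(1)[of u'] \<open>\<epsilon> > 0\<close> by (intro mult_right_mono) auto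
        finally show "\<bar>p x i - p y i\<bar> \<le> \<kappa> * (p y i + \<epsilon>)"
          by (simp add: p_def u_def u'_def \<kappa>_def)
      qed (use chain_facts \<open>\<epsilon> > 0\<close> \<open>D \<ge> 0\<close> \<open>\<kappa> \<ge> 0\<close> in auto)
      also have "\<dots> \<le> D * \<kappa> * 2"
      proof (rule mult_left_mono)
        have "card ?I \<le> 4 * (n + 1)"
          using card_Un_le[of "active x" "active y"] active_card[OF x] active_card[OF y] by linarith
        then have "real (card ?I) \<le> real (4 * (n + 1))"
          by (rule of_nat_mono)
        then have "\<epsilon> * length ?L \<le> 1"
          by (simp add: \<epsilon>_def field_simps)
        then show "1 + \<epsilon> * length ?L \<le> 2" by simp
      qed (use \<open>D \<ge> 0\<close> \<open>\<kappa> \<ge> 0\<close> in simp)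
      \<comment> \<open>As \<open>\<Lambda> \<ge> 3\<close>, the threshold gives
        \<open>\<delta> \<le> \<tau> / 6\<close>. Then \<open>D\<close> is at most a multiple of
        \<open>\<tau>\<close>, which cancels the denominator of \<open>\<kappa>\<close> and leaves a
        multiple of \<open>\<l> * \<delta>\<close>.\<close>
      also have "\<dots> \<le> ((4 + 10 * c) * 2 * (7 / 6 * \<tau>) + \<tau> / 6) * \<kappa> * 2"
      proof -
        have "6 * \<delta> \<le> 2 * \<Lambda> * \<delta>"
          using \<l> \<open>\<delta> \<ge> 0\<close> by (intro mult_right_mono) (auto simp: \<Lambda>_def)
        then have "\<delta> \<le> \<tau> / 6"
          using True by simp
        then have "D \<le> (4 + 10 * c) * 2 * (7 / 6 * \<tau>) + \<tau> / 6"
          using c_pos unfolding D_def by (intro add_mono mult_left_mono) auto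
        then show ?thesis
          using \<open>\<kappa> \<ge> 0\<close> by (intro mult_right_mono) auto
      qed
      also have "\<dots> = (228 + 560 * c) * (\<l> * \<delta>)"
        using \<open>\<tau> > 0\<close> by (simp add: \<kappa>_def \<Lambda>_def field_simps)
      also have "\<dots> \<le> (1000 * (c + 1)) * (\<l> * \<delta>)"
        using c_pos \<l> \<open>\<delta> \<ge> 0\<close> by (intro mult_right_mono) auto
      finally show ?thesis
        by (simp add: \<delta>_def mult.assoc)
    qed
  qed
  have "(1000 * (c + 1) * \<l>)-lipschitz_on (A \<union> {x. infdist x A > 0}) F"
  proof (rule lipschitz_onI)
    fix x y assume xy: "x \<in> A \<union> {x. infdist x A > 0}" "y \<in> A \<union> {x. infdist x A > 0}"
    consider "x \<in> A" "y \<in> A" | "x \<in> A" "infdist y A > 0" | "infdist x A > 0" "y \<in> A"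
      | "infdist x A > 0" "infdist y A > 0"
      using xy by blast
    then show "dist (F x) (F y) \<le> 1000 * (c + 1) * \<l> * dist x y"
    proof cases
      case 1
      have "1 * 1 \<le> (1000 * (c + 1)) * \<l>"
        using c_pos \<l> by (intro mult_mono) auto
      then have "1 * dist x y \<le> 1000 * (c + 1) * \<l> * dist x y"
        by (intro mult_right_mono) auto
      then show ?thesis
        using 1 f_dist[of x y] by (simp add: F_def)
    next
      case 2
      then show ?thesis by (rule bound_A)
    next
      case 3
      then show ?thesis using bound_A[of y x] by (simp add: dist_commute)
    next
      case 4
      then show ?thesis by (rule bound_off)
    qed
  qed (use c_pos \<l> in simp)
  moreover have "F ` (A \<union> {x. infdist x A > 0}) \<subseteq> Y"
    using F_in by auto
  ultimately show ?thesis
    unfolding \<l>_def by (intro exI[of _ F]) (auto simp: F_def)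
qed

end

section \<open>Assembling the coverings, the bicombing and the passage to the closure\<close>

theorem theorem1p2:
  fixes n :: nat and c :: real
    and X A :: "'a::metric_space set" and Y :: "'b::metric_space set"
    and f :: "'a \<Rightarrow> 'b"
  assumes "c > 0"
    and "A \<subseteq> X"
    and "Nagata n c A"
    and "Y \<noteq> {}"
    and "complete Y"
    and "generalized_nonpos_curvature Y"
    and "f ` A \<subseteq> Y"
    and "1-lipschitz_on A f"
  shows "\<exists>F. F ` X \<subseteq> Y \<and> (\<forall>x\<in>A. F x = f x) \<and>
           (1000 * (c + 1) * log 2 (real n + 2))-lipschitz_on X F"
proof (cases "A = {}")
  \<comment> \<open>With no values prescribed, a constant map works; its value exists because
    \<open>Y\<close> is non-empty.\<close>
  case True
  obtain y where "y \<in> Y"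
    using assms(4) by blast
  have "0 \<le> 1000 * (c + 1) * log 2 (real n + 2)"
    using assms(1) by simp
  then have "(1000 * (c + 1) * log 2 (real n + 2))-lipschitz_on X (\<lambda>_. y)"
    by (intro lipschitz_onI) auto
  then show ?thesis
    using True \<open>y \<in> Y\<close> by (intro exI[of _ "\<lambda>_. y"]) auto
next
  case False
  have "\<exists>m. midpoint_map Y m"
    using assms(6) unfolding generalized_nonpos_curvature_def midpoint_map_def
    by (elim ex_forward) simp
  then obtain \<sigma> where \<sigma>: "conical_bicombing Y \<sigma>"
    using midpoint_map.conical_bicombing_exists[OF _ assms(5)] by metis
  have "\<exists>C :: int \<Rightarrow> 'a set set. \<forall>j. \<Union>(C j) = A \<and> {} \<notin> C j \<and>
    (\<forall>x. finite {B\<in>C j. infdist x B < 2 * 2 powr j} \<and> card {B\<in>C j. infdist x B < 2 * 2 powr j} \<le> n + 1) \<and>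
    (\<forall>B\<in>C j. \<forall>a\<in>B. \<forall>b\<in>B. dist a b \<le> 5 * c * 2 powr j)"
    by (intro choice allI Nagata_cover[OF assms(3)]) simp
  then have "\<exists>C. dyadic_covers A n c C"
    using False assms(1) unfolding dyadic_covers_def by (elim ex_forward) simp
  then obtain C where "dyadic_covers A n c C" ..
  then interpret whitney_extension A n c C Y \<sigma> f
    using \<sigma> assms(7,8) by (simp add: whitney_extension_def whitney_extension_axioms_def)
  let ?S = "A \<union> {x. infdist x A > 0}"
  obtain F where F: "F ` ?S \<subseteq> Y" "\<forall>x\<in>A. F x = f x"
      "(1000 * (c + 1) * log 2 (real n + 2))-lipschitz_on ?S F"
    using extension_off_boundary by metis
  \<comment> \<open>A point at distance zero from \<open>A\<close> lies in the closure of
    \<open>A\<close>, so \<open>?S\<close> misses only limit points of \<open>A\<close>; these are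
    reached by continuity, using completeness of \<open>Y\<close>.\<close>
  have "x \<in> closure ?S" for x
  proof (cases "infdist x A > 0")
    case True
    then show ?thesis
      by (intro subsetD[OF closure_subset]) simp
  next
    case False
    then have "x \<in> closure A"
      using in_closure_iff_infdist_zero[OF A_nonempty] infdist_nonneg[of x A] by force
    then show ?thesis
      by (rule subsetD[OF closure_mono, rotated]) simp
  qed
  then have "X \<subseteq> closure ?S" ..
  from lipschitz_extension_to_closure[OF F(3,1) assms(5) this]
  obtain G where "G ` X \<subseteq> Y \<and> (\<forall>x\<in>?S. G x = F x) \<and>
      (1000 * (c + 1) * log 2 (real n + 2))-lipschitz_on X G" ..
  then show ?thesis
    using F(2) by (intro exI[of _ G]) simp
qed

end
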